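(* Let $(\mathfrak{g},B,\omega)$ be a (finite-dimensional, complex) symplectic quadratic Lie algebra. Let $\phi:\mathfrak{g}\to\mathfrak{g}^*$ be the map $\phi(X)=B(X,\cdot)$, and consider the mapping $\mathcal{D}:\operatorname{ad}(\mathfrak{g})\to\operatorname{ad}(\mathfrak{g})$ defined by $$\mathcal{D}(\operatorname{ad}(X))=\operatorname{ad}\left(\phi^{-1}\left(\iota_X(\omega)\right)\right),\qquad X\in\mathfrak{g}.$$ Then $\mathcal{D}$ is an invertible derivation of the Lie algebra $\operatorname{ad}(\mathfrak{g})$.
   Context: A quadratic Lie algebra $(\mathfrak{g},B)$ is a finite-dimensional complex Lie algebra $\mathfrak{g}$ endowed with a non-degenerate symmetric bilinear form $B$ that is invariant: $B([X,Y],Z)=B(X,[Y,Z])$ for all $X,Y,Z\in\mathfrak{g}$. A symplectic structure on $\mathfrak{g}$ is a non-degenerate skew-symmetric bilinear form $\omega:\mathfrak{g}\times\mathfrak{g}\to\mathbb{C}$ such that $\omega([X,Y],Z)+\omega([Y,Z],X)+\omega([Z,X],Y)=0$ for all $X,Y,Z\in\mathfrak{g}$. A symplectic quadratic Lie algebra $(\mathfrak{g},B,\omega)$ is a quadratic Lie algebra $(\mathfrak{g},B)$ together with a symplectic structure $\omega$ on $\mathfrak{g}$. Here $\iota_X(\omega)=\omega(X,\cdot)\in\mathfrak{g}^*$, and $\operatorname{ad}(\mathfrak{g})=\{\operatorname{ad}(X)\mid X\in\mathfrak{g}\}$ is the Lie algebra of inner derivations of $\mathfrak{g}$ (with the commutator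 bracket). *)

theory Defs
  imports Complex_Main "HOL-Library.FuncSet" "HOL-Library.Function_Algebras"
begin

(* A Lie algebra is a bracket on a subspace L of an ambient vector space. The algebra g itself
   is the case L = UNIV; ad(g) is a subspace of the space of all functions from g to g. *)

locale lie_algebra = vector_space scale
  for scale :: "'k::field \<Rightarrow> 'a::ab_group_add \<Rightarrow> 'a" +
  fixes bracket :: "'a \<Rightarrow> 'a \<Rightarrow> 'a"
    and L :: "'a set"
  assumes subspace_carrier: "subspace L"
    and bracket_closed: "x \<in> L \<Longrightarrow> y \<in> L \<Longrightarrow> bracket x y \<in> L"
    and bracket_add_left:
      "x \<in> L \<Longrightarrow> y \<in> L \<Longrightarrow> z \<in> L \<Longrightarrow> bracket (x + y) z = bracket x z + bracket y z"
    and bracket_add_right: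
      "x \<in> L \<Longrightarrow> y \<in> L \<Longrightarrow> z \<in> L \<Longrightarrow> bracket x (y + z) = bracket x y + bracket x z"
    and bracket_scale_left:
      "x \<in> L \<Longrightarrow> y \<in> L \<Longrightarrow> bracket (scale c x) y = scale c (bracket x y)"
    and bracket_scale_right:
      "x \<in> L \<Longrightarrow> y \<in> L \<Longrightarrow> bracket x (scale c y) = scale c (bracket x y)"
    and bracket_self: "x \<in> L \<Longrightarrow> bracket x x = 0"
    and jacobi:
      "x \<in> L \<Longrightarrow> y \<in> L \<Longrightarrow> z \<in> L \<Longrightarrow>
        bracket x (bracket y z) + bracket y (bracket z x) + bracket z (bracket x y) = 0"

definition derivation ::
  "('k \<Rightarrow> 'a::ab_group_add \<Rightarrow> 'a) \<Rightarrow> ('a \<Rightarrow> 'a \<Rightarrow> 'a) \<Rightarrow> 'a set \<Rightarrow> ('a \<Rightarrow> 'a) \<Rightarrow> bool"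
where
  "derivation scale bracket L D \<longleftrightarrow>
     D \<in> L \<rightarrow> L \<and>
     (\<forall>x\<in>L. \<forall>y\<in>L. D (x + y) = D x + D y) \<and>
     (\<forall>c. \<forall>x\<in>L. D (scale c x) = scale c (D x)) \<and>
     (\<forall>x\<in>L. \<forall>y\<in>L. D (bracket x y) = bracket (D x) y + bracket x (D y))"

definition invertible_derivation ::
  "('k \<Rightarrow> 'a::ab_group_add \<Rightarrow> 'a) \<Rightarrow> ('a \<Rightarrow> 'a \<Rightarrow> 'a) \<Rightarrow> 'a set \<Rightarrow> ('a \<Rightarrow> 'a) \<Rightarrow> bool"
where
  "invertible_derivation scale bracket L D \<longleftrightarrow> derivation scale bracket L D \<and> bij_betw D L L"

definition ad :: "('a \<Rightarrow> 'a \<Rightarrow> 'a) \<Rightarrow> 'a \<Rightarrow> ('a \<Rightarrow> 'a)" where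
  "ad bracket X = (\<lambda>Y. bracket X Y)"

definition ad_algebra :: "('a \<Rightarrow> 'a \<Rightarrow> 'a) \<Rightarrow> ('a \<Rightarrow> 'a) set" where
  "ad_algebra bracket = range (ad bracket)"

definition commutator ::
  "('a::ab_group_add \<Rightarrow> 'a) \<Rightarrow> ('a \<Rightarrow> 'a) \<Rightarrow> ('a \<Rightarrow> 'a)" where
  "commutator S T = (S \<circ> T) - (T \<circ> S)"

definition pointwise_scale ::
  "('k \<Rightarrow> 'a \<Rightarrow> 'a) \<Rightarrow> 'k \<Rightarrow> ('b \<Rightarrow> 'a) \<Rightarrow> ('b \<Rightarrow> 'a)" where
  "pointwise_scale scale c T = (\<lambda>Y. scale c (T Y))"

definition dual_space :: "('k::field \<Rightarrow> 'a::ab_group_add \<Rightarrow> 'a) \<Rightarrow> ('a \<Rightarrow> 'k) set" where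
  "dual_space scale = {f. Vector_Spaces.linear scale (*) f}"

definition bilinear_form ::
  "('k::field \<Rightarrow> 'a::ab_group_add \<Rightarrow> 'a) \<Rightarrow> ('a \<Rightarrow> 'a \<Rightarrow> 'k) \<Rightarrow> bool" where
  "bilinear_form scale f \<longleftrightarrow>
     (\<forall>X. Vector_Spaces.linear scale (*) (\<lambda>Y. f X Y)) \<and>
     (\<forall>Y. Vector_Spaces.linear scale (*) (\<lambda>X. f X Y))"

definition nondegenerate :: "('a::zero \<Rightarrow> 'a \<Rightarrow> 'k::zero) \<Rightarrow> bool" where
  "nondegenerate f \<longleftrightarrow>
     (\<forall>X. (\<forall>Y. f X Y = 0) \<longrightarrow> X = 0) \<and> (\<forall>Y. (\<forall>X. f X Y = 0) \<longrightarrow> Y = 0)"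

locale quadratic_lie_algebra = lie_algebra scale bracket UNIV
  for scale :: "complex \<Rightarrow> 'a::ab_group_add \<Rightarrow> 'a"
    and bracket :: "'a \<Rightarrow> 'a \<Rightarrow> 'a" +
  fixes B :: "'a \<Rightarrow> 'a \<Rightarrow> complex"
  assumes finite_dimensional: "\<exists>Basis. finite_dimensional_vector_space scale Basis"
    and bilinear_B: "bilinear_form scale B"
    and symmetric_B: "B X Y = B Y X"
    and nondegenerate_B: "nondegenerate B"
    and invariant_B: "B (bracket X Y) Z = B X (bracket Y Z)"

locale symplectic_quadratic_lie_algebra = quadratic_lie_algebra scale bracket B
  for scale :: "complex \<Rightarrow> 'a::ab_group_add \<Rightarrow> 'a"
    and bracket :: "'a \<Rightarrow> 'a \<Rightarrow> 'a"
    and B :: "'a \<Rightarrow> 'a \<Rightarrow> complex" +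
  fixes \<omega> :: "'a \<Rightarrow> 'a \<Rightarrow> complex"
  assumes bilinear_\<omega>: "bilinear_form scale \<omega>"
    and skew_symmetric_\<omega>: "\<omega> X Y = - \<omega> Y X"
    and nondegenerate_\<omega>: "nondegenerate \<omega>"
    and cocycle_\<omega>: "\<omega> (bracket X Y) Z + \<omega> (bracket Y Z) X + \<omega> (bracket Z X) Y = 0"

definition \<phi> :: "('a \<Rightarrow> 'a \<Rightarrow> complex) \<Rightarrow> 'a \<Rightarrow> ('a \<Rightarrow> complex)" where
  "\<phi> B X = (\<lambda>Y. B X Y)"

definition contraction :: "'a \<Rightarrow> ('a \<Rightarrow> 'a \<Rightarrow> complex) \<Rightarrow> ('a \<Rightarrow> complex)" ("\<iota>") where
  "\<iota> X \<omega> = (\<lambda>Y. \<omega> X Y)"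

(* The function type contains more than the dual space; the next two lemmas guarantee that
   inv (\<phi> B) is a genuine inverse of \<phi> B at every functional \<iota> X \<omega>. *)

lemma (in quadratic_lie_algebra) bij_betw_\<phi>: "bij_betw (\<phi> B) UNIV (dual_space scale)"
proof -
  obtain Basis where "finite_dimensional_vector_space scale Basis"
    using finite_dimensional by blast
  then interpret V: finite_dimensional_vector_space scale Basis .
  interpret VV: finite_dimensional_vector_space_pair scale Basis scale Basis
    by unfold_locales
  have linR: "Vector_Spaces.linear scale (*) (\<lambda>Y. B X Y)" for X
    using bilinear_B by (simp add: bilinear_form_def)
  have linL: "Vector_Spaces.linear scale (*) (\<lambda>X. B X Y)" for Y
    using bilinear_B by (simp add: bilinear_form_def)
  interpret K: vector_space "(*) :: complex \<Rightarrow> complex \<Rightarrow> complex"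
    using linR by (rule Vector_Spaces.linear.axioms(2))
  interpret VK: vector_space_pair scale "(*) :: complex \<Rightarrow> complex \<Rightarrow> complex"
    by unfold_locales
  have addL: "B (x + y) z = B x z + B y z" for x y z
    using VK.linear_add[OF linL] .
  have scL: "B (scale c x) z = c * B x z" for c x z
    using VK.linear_scale[OF linL] .
  have eq_functional: "f = g"
    if "Vector_Spaces.linear scale (*) f" "Vector_Spaces.linear scale (*) g"
      "\<And>b. b \<in> Basis \<Longrightarrow> f b = g b" for f g :: "'a \<Rightarrow> complex"
    using VK.linear_eq_on[OF that(1,2), of _ Basis] that(3) V.span_Basis by auto
  have zero_lin: "Vector_Spaces.linear scale (*) (\<lambda>_. 0 :: complex)"
    by (rule VK.linear_zero)
  have trivial_left: "X = 0" if "\<And>Y. B X Y = 0" for X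
    using nondegenerate_B that by (simp add: nondegenerate_def)
  have "inj (\<phi> B)"
  proof (rule injI)
    fix X Y assume "\<phi> B X = \<phi> B Y"
    then have e: "B X Z = B Y Z" for Z unfolding \<phi>_def by (rule fun_cong)
    have "B (X - Y) Z = 0" for Z using VK.linear_diff[OF linL] e by simp
    then show "X = Y" using trivial_left by fastforce
  qed
  moreover have "range (\<phi> B) = dual_space scale"
  proof
    show "range (\<phi> B) \<subseteq> dual_space scale"
      using linR by (auto simp: dual_space_def \<phi>_def)
    define T where "T X = (\<Sum>b\<in>Basis. scale (B X b) b)" for X
    have T: "Vector_Spaces.linear scale scale T"
      unfolding Vector_Spaces.linear_iff
      by (simp add: vector_space_axioms T_def addL scL scale_left_distrib sum.distrib scale_sum_right)
    have coeff: "u b = v b"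
      if "(\<Sum>b\<in>Basis. scale (u b) b) = (\<Sum>b\<in>Basis. scale (v b) b)" "b \<in> Basis" for u v b
    proof -
      have "(\<Sum>b\<in>Basis. scale (u b - v b) b) = 0"
        using that(1) by (simp add: scale_left_diff_distrib sum_subtractf)
      from independentD[OF V.independent_Basis V.finite_Basis order_refl this that(2)]
      show ?thesis by simp
    qed
    have "inj T"
    proof (subst VV.linear_inj_iff_eq_0[OF T], intro allI impI)
      fix X assume "T X = 0"
      then have "(\<Sum>b\<in>Basis. scale (B X b) b) = (\<Sum>b\<in>Basis. scale 0 b)" by (simp add: T_def)
      then have "B X b = 0" if "b \<in> Basis" for b
        using coeff[of "B X" "\<lambda>_. 0"] that by simp
      then have "(\<lambda>Y. B X Y) = (\<lambda>_. 0)"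
        by (intro eq_functional linR zero_lin)
      then show "X = 0" by (intro trivial_left) (rule fun_cong)
    qed
    then have "surj T" by (rule V.linear_inj_imp_surj[OF T])
    show "dual_space scale \<subseteq> range (\<phi> B)"
    proof
      fix f assume "f \<in> dual_space scale"
      then have f: "Vector_Spaces.linear scale (*) f" by (simp add: dual_space_def)
      obtain X where "T X = (\<Sum>b\<in>Basis. scale (f b) b)" using \<open>surj T\<close> by (metis surjD)
      then have "B X b = f b" if "b \<in> Basis" for b
        using coeff[of "B X" f] that by (simp add: T_def)
      then have "\<phi> B X = f" unfolding \<phi>_def by (intro eq_functional linR f)
      then show "f \<in> range (\<phi> B)" by blast
    qed
  qed
  ultimately show ?thesis by (simp add: bij_betw_def)
qed

lemma (in symplectic_quadratic_lie_algebra) contraction_in_dual: "\<iota> X \<omega> \<in> dual_space scale"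
  using bilinear_\<omega> by (simp add: bilinear_form_def dual_space_def contraction_def)

lemma lie_algebra_ad_algebra:
  fixes scale :: "'k::field \<Rightarrow> 'a::ab_group_add \<Rightarrow> 'a"
  assumes "lie_algebra scale bracket UNIV"
  shows "lie_algebra (pointwise_scale scale) commutator (ad_algebra bracket)"
proof -
  interpret g: lie_algebra scale bracket UNIV by fact
  interpret E: vector_space "pointwise_scale scale :: _ \<Rightarrow> ('a \<Rightarrow> 'a) \<Rightarrow> _"
    by unfold_locales
      (auto simp: pointwise_scale_def fun_eq_iff g.scale_right_distrib g.scale_left_distrib)
  note br = g.bracket_add_left[simplified] g.bracket_add_right[simplified]
    g.bracket_scale_left[simplified] g.bracket_scale_right[simplified]
  have addR: "bracket x (y - z) = bracket x y - bracket x z" for x y z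
    by (metis add_diff_cancel_right' br(2) diff_add_cancel)
  have skew: "bracket x y = - bracket y x" for x y
  proof -
    have "bracket (x + y) (x + y) = 0" "bracket x x = 0" "bracket y y = 0"
      using g.bracket_self by simp_all
    then show ?thesis by (simp add: br eq_neg_iff_add_eq_0 add.commute)
  qed
  have minusR: "bracket x (- y) = - bracket x y" for x y
    using addR[of x 0 y] addR[of x 0 0] by simp
  have comm: "commutator (ad bracket x) (ad bracket y) = ad bracket (bracket x y)" for x y
  proof
    fix z
    have "bracket x (bracket y z) + bracket y (bracket z x) + bracket z (bracket x y) = 0"
      using g.jacobi by simp
    moreover have "bracket y (bracket z x) = - bracket y (bracket x z)"
      using skew[of z x] minusR by simp
    moreover have "bracket z (bracket x y) = - bracket (bracket x y) z" by (rule skew)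
    ultimately show "commutator (ad bracket x) (ad bracket y) z = ad bracket (bracket x y) z"
      unfolding commutator_def ad_def fun_diff_def comp_def by (simp add: algebra_simps)
  qed
  have add: "ad bracket x + ad bracket y = ad bracket (x + y)" for x y
    by (simp add: fun_eq_iff ad_def br)
  have sc: "pointwise_scale scale c (ad bracket x) = ad bracket (scale c x)" for c x
    by (simp add: fun_eq_iff ad_def br pointwise_scale_def)
  have zero: "ad bracket 0 = 0"
    using add[of 0 0] by simp
  have adj: "bracket x x = 0" for x using g.bracket_self by simp
  have jac: "bracket x (bracket y z) + bracket y (bracket z x) + bracket z (bracket x y) = 0"
    for x y z using g.jacobi by simp
  show ?thesis
    unfolding ad_algebra_def
  proof unfold_locales
    show "E.subspace (range (ad bracket))"
      unfolding E.subspace_def using zero[symmetric] by (auto simp: add sc)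
  next
    fix S T assume "S \<in> range (ad bracket)" "T \<in> range (ad bracket)"
    then show "commutator S T \<in> range (ad bracket)" using comm by auto
  next
    fix S T U
    assume "S \<in> range (ad bracket)" "T \<in> range (ad bracket)" "U \<in> range (ad bracket)"
    then obtain x y z where e: "S = ad bracket x" "T = ad bracket y" "U = ad bracket z"
      by blast
    show "commutator (S + T) U = commutator S U + commutator T U"
      "commutator S (T + U) = commutator S T + commutator S U"
      unfolding e comm add br by (rule refl)+
    show "commutator S (commutator T U) + commutator T (commutator U S) +
        commutator U (commutator S T) = 0"
      unfolding e comm add jac zero by (rule refl)
  next
    fix S T c
    assume "S \<in> range (ad bracket)" "T \<in> range (ad bracket)"
    then obtain x y where e: "S = ad bracket x" "T = ad bracket y"
      by blast
    show "commutator (pointwise_scale scale c S) T = pointwise_scale scale c (commutator S T)"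
      "commutator S (pointwise_scale scale c T) = pointwise_scale scale c (commutator S T)"
      unfolding e comm sc br by (rule refl)+
  next
    fix S assume "S \<in> range (ad bracket)"
    then show "commutator S S = 0" by (auto simp: comm adj zero)
  qed
qed

end

theory Submission
  imports Defs
begin

text \<open>
  The map \<open>D X = \<phi>\<inverse> (\<iota> X \<omega>)\<close> is characterised by \<open>B (D X) Y = \<omega> X Y\<close>. By skew-symmetry
  of \<open>\<omega>\<close>, invariance of \<open>B\<close> turns the cocycle identity into the Leibniz rule,
  and nondegeneracy of \<open>\<omega>\<close> makes \<open>D\<close> injective. A derivation preserves the centre; by finite
  dimension an injective one maps the centre onto itself. Hence \<open>D X\<close> is central iff \<open>X\<close> is, which
  says that \<open>D\<close> descends to an injective map on \<open>ad(g)\<close>.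
\<close>

lemma linear_functional_simps:
  assumes "Vector_Spaces.linear scale ((*) :: 'k::field \<Rightarrow> 'k \<Rightarrow> 'k) f"
  shows "f (x + y) = f x + f y" and "f (scale c x) = c * f x" and "f (x - y) = f x - f y"
proof -
  interpret Vector_Spaces.linear scale "(*) :: 'k \<Rightarrow> 'k \<Rightarrow> 'k" f by fact
  show "f (x + y) = f x + f y" "f (scale c x) = c * f x" "f (x - y) = f x - f y"
    by (rule add scale diff)+
qed

context quadratic_lie_algebra
begin

text \<open>Phrased as the kernel of \<open>ad bracket\<close>, the form needed to decide when two
  elements have the same adjoint map.\<close>

definition center :: "'a set" where
  "center = {X. ad bracket X = 0}"

lemmas bracket_simps = bracket_add_left[simplified] bracket_add_right[simplified]
  bracket_scale_left[simplified] bracket_scale_right[simplified]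

lemma
  shows B_add_left: "B (x + y) z = B x z + B y z"
    and B_scale_left: "B (scale c x) z = c * B x z"
    and B_diff_left: "B (x - y) z = B x z - B y z"
  using linear_functional_simps[of scale "\<lambda>x. B x z"] bilinear_B
  unfolding bilinear_form_def by blast+

lemma B_eqI: "(\<And>Z. B X Z = B Y Z) \<Longrightarrow> X = Y"
  using nondegenerate_B B_diff_left unfolding nondegenerate_def
  by (metis eq_iff_diff_eq_0)

lemma
  shows ad_add: "ad bracket X + ad bracket Y = ad bracket (X + Y)"
    and ad_scale: "pointwise_scale scale c (ad bracket X) = ad bracket (scale c X)"
    and ad_diff: "ad bracket X - ad bracket Y = ad bracket (X - Y)"
proof -
  show add: "ad bracket X + ad bracket Y = ad bracket (X + Y)" for X Y
    by (simp add: fun_eq_iff ad_def bracket_simps)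
  show "pointwise_scale scale c (ad bracket X) = ad bracket (scale c X)"
    by (simp add: fun_eq_iff ad_def bracket_simps pointwise_scale_def)
  show "ad bracket X - ad bracket Y = ad bracket (X - Y)"
    using add[of "X - Y" Y] by (simp add: diff_eq_eq)
qed

lemma bracket_anticomm: "bracket X Y = - bracket Y X"
  using bracket_self[of "X + Y"] bracket_self[of X] bracket_self[of Y]
  by (simp add: bracket_simps eq_neg_iff_add_eq_0 add.commute)

lemma commutator_ad: "commutator (ad bracket X) (ad bracket Y) = ad bracket (bracket X Y)"
proof
  fix Z
  have "bracket Z X + bracket X Z = 0"
    using bracket_anticomm[of Z X] by simp
  \<comment> \<open>Additivity at 0 and 0 gives \<open>bracket Y 0 = 0\<close>, so the sign can be
    pulled out of \<open>bracket Y\<close>.\<close>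
  then have "bracket Y (bracket Z X) = - bracket Y (bracket X Z)"
    using bracket_simps(2)[of Y "bracket Z X" "bracket X Z"] bracket_simps(2)[of Y 0 0]
    by (simp add: eq_neg_iff_add_eq_0)
  then show "commutator (ad bracket X) (ad bracket Y) Z = ad bracket (bracket X Y) Z"
    using jacobi[of X Y Z] bracket_anticomm[of Z "bracket X Y"]
    by (simp add: commutator_def ad_def algebra_simps)
qed

lemma ad_eq_iff: "ad bracket X = ad bracket Y \<longleftrightarrow> X - Y \<in> center"
  by (simp add: center_def flip: ad_diff)

lemma subspace_center: "subspace center"
proof -
  have "ad bracket 0 = 0"
    using ad_add[of 0 0] by simp
  moreover have "pointwise_scale scale c 0 = (0 :: 'a \<Rightarrow> 'a)" for c
    by (simp add: pointwise_scale_def fun_eq_iff)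
  ultimately show ?thesis
    by (simp add: subspace_def center_def flip: ad_add ad_scale)
qed

end

context symplectic_quadratic_lie_algebra
begin

definition D :: "'a \<Rightarrow> 'a" where
  "D X = inv (\<phi> B) (\<iota> X \<omega>)"

lemma
  shows \<omega>_add_left: "\<omega> (x + y) z = \<omega> x z + \<omega> y z"
    and \<omega>_scale_left: "\<omega> (scale c x) z = c * \<omega> x z"
  using linear_functional_simps[of scale "\<lambda>x. \<omega> x z"] bilinear_\<omega>
  unfolding bilinear_form_def by blast+

lemma B_D: "B (D X) Y = \<omega> X Y"
proof -
  \<comment> \<open>\<open>inv\<close> yields a true preimage only on the range of
    \<open>\<phi> B\<close>, which is the dual space.\<close>
  have "\<iota> X \<omega> \<in> range (\<phi> B)"
    using bij_betw_\<phi> contraction_in_dual by (simp add: bij_betw_def)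
  then have "\<phi> B (D X) = \<iota> X \<omega>"
    unfolding D_def by (rule f_inv_into_f)
  then show ?thesis
    unfolding \<phi>_def contraction_def by (rule fun_cong)
qed

lemma D_add: "D (X + Y) = D X + D Y"
  by (rule B_eqI) (simp add: B_D B_add_left \<omega>_add_left)

lemma D_scale: "D (scale c X) = scale c (D X)"
  by (rule B_eqI) (simp add: B_D B_scale_left \<omega>_scale_left)

lemma linear_D: "Vector_Spaces.linear scale scale D"
  unfolding Vector_Spaces.linear_iff by (simp add: vector_space_axioms D_add D_scale)

lemma D_bracket: "D (bracket X Y) = bracket (D X) Y + bracket X (D Y)"
proof (rule B_eqI)
  fix Z
  \<comment> \<open>\<open>B (bracket (D X) Y) Z = B (D X) (bracket Y Z) = \<omega> X (bracket Y
    Z)\<close>.\<close>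
  have "\<omega> (bracket Y Z) X = - B (bracket (D X) Y) Z"
    using skew_symmetric_\<omega>[of "bracket Y Z" X] by (simp add: invariant_B flip: B_D)
  \<comment> \<open>Symmetry of \<open>B\<close> between two uses of invariance rotates the
    arguments: \<open>B (bracket X (D Y)) Z = B (bracket (D Y) Z) X = B (D Y) (bracket Z
    X)\<close>.\<close>
  moreover have "\<omega> (bracket Z X) Y = - B (bracket X (D Y)) Z"
    using skew_symmetric_\<omega>[of "bracket Z X" Y]
    by (simp add: invariant_B symmetric_B[of X] flip: B_D)
  ultimately show "B (D (bracket X Y)) Z = B (bracket (D X) Y + bracket X (D Y)) Z"
    using cocycle_\<omega>[of X Y Z] by (simp add: B_D B_add_left algebra_simps)
qed

lemma inj_D: "inj D"
proof -
  interpret D: Vector_Spaces.linear scale scale D by (rule linear_D)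
  have "B 0 Y = 0" for Y
    using B_scale_left[of 0 0 Y] by simp
  then have "X = 0" if "D X = 0" for X
    using nondegenerate_\<omega> B_D[of X] that unfolding nondegenerate_def by metis
  then show ?thesis
    by (simp add: D.inj_iff_eq_0)
qed

lemma surj_D: "surj D"
proof -
  obtain Basis where "finite_dimensional_vector_space scale Basis"
    using finite_dimensional by blast
  then interpret V: finite_dimensional_vector_space scale Basis .
  show ?thesis
    by (rule V.linear_inj_imp_surj[OF linear_D inj_D])
qed

lemma D_image_center: "D ` center = center"
proof -
  obtain Basis where "finite_dimensional_vector_space scale Basis"
    using finite_dimensional by blast
  then interpret V: finite_dimensional_vector_space scale Basis .
  interpret VV: finite_dimensional_vector_space_pair scale Basis scale Basis
    by unfold_locales
  interpret D: Vector_Spaces.linear scale scale D by (rule linear_D)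
  \<comment> \<open>For central \<open>X\<close>, both \<open>bracket X Y\<close> and
    \<open>bracket X (D Y)\<close> vanish, so the Leibniz rule leaves
    \<open>bracket (D X) Y = 0\<close>.\<close>
  have "D X \<in> center" if "X \<in> center" for X
  proof -
    have "bracket X Y = 0" for Y
      using that by (simp add: center_def ad_def fun_eq_iff)
    then have "bracket (D X) Y = 0" for Y
      using D_bracket[of X Y] D.zero by simp
    then show ?thesis
      by (simp add: center_def ad_def fun_eq_iff)
  qed
  then have "D ` center \<subseteq> center" by blast
  moreover have "dim (D ` center) = dim center"
    using inj_D by (intro VV.dim_image_eq[OF linear_D]) (rule inj_on_subset, auto)
  ultimately show ?thesis
    using subspace_center by (intro V.subspace_dim_equal D.subspace_image) simp_all
qed

text \<open>A central \<open>D X\<close> equals \<open>D Z\<close> for some central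
  \<open>Z\<close>, and injectivity forces \<open>X = Z\<close>.\<close>

lemma D_in_center_iff: "D X \<in> center \<longleftrightarrow> X \<in> center"
  using D_image_center inj_D by (metis inj_image_mem_iff)

text \<open>Right to left makes the induced map well defined; left to right makes it
  injective.\<close>

lemma ad_D_eq_iff: "ad bracket (D X) = ad bracket (D Y) \<longleftrightarrow> ad bracket X = ad bracket Y"
proof -
  interpret D: Vector_Spaces.linear scale scale D by (rule linear_D)
  show ?thesis
    by (simp add: ad_eq_iff D_in_center_iff flip: D.diff)
qed

lemma induced_map_exists: "\<exists>\<D>. \<forall>X. \<D> (ad bracket X) = ad bracket (D X)"
proof
  \<comment> \<open>The witness applies \<open>D\<close> to an arbitrary preimage of
    \<open>S\<close>; the choice does not affect the result.\<close>
  show "\<forall>X. (\<lambda>S. ad bracket (D (inv (ad bracket) S))) (ad bracket X) = ad bracket (D X)"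
    by (simp add: ad_D_eq_iff f_inv_into_f)
qed

text \<open>Linearity, the Leibniz rule and surjectivity descend from \<open>D\<close> because
  \<open>ad bracket\<close> is linear, maps onto \<open>ad_algebra bracket\<close> and turns
  brackets into commutators.\<close>

lemma induced_map_invertible_derivation:
  assumes \<D>: "\<And>X. \<D> (ad bracket X) = ad bracket (D X)"
  shows "invertible_derivation (pointwise_scale scale) commutator (ad_algebra bracket) \<D>"
proof -
  have "inj_on \<D> (ad_algebra bracket)"
    by (auto simp: inj_on_def ad_algebra_def \<D> ad_D_eq_iff)
  moreover have "\<D> ` ad_algebra bracket = ad bracket ` range D"
    by (simp add: ad_algebra_def image_image \<D>)
  then have "\<D> ` ad_algebra bracket = ad_algebra bracket"
    by (simp add: surj_D ad_algebra_def)
  moreover have "derivation (pointwise_scale scale) commutator (ad_algebra bracket) \<D>"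
    by (auto simp: derivation_def ad_algebra_def \<D> ad_add ad_scale commutator_ad
        D_add D_scale D_bracket)
  ultimately show ?thesis
    by (simp add: invertible_derivation_def bij_betw_def)
qed

end

theorem theorem1:
  fixes scale :: "complex \<Rightarrow> 'a::ab_group_add \<Rightarrow> 'a"
    and bracket :: "'a \<Rightarrow> 'a \<Rightarrow> 'a"
    and B \<omega> :: "'a \<Rightarrow> 'a \<Rightarrow> complex"
  assumes "symplectic_quadratic_lie_algebra scale bracket B \<omega>"
  shows "(\<exists>\<D>. \<forall>X. \<D> (ad bracket X) = ad bracket (inv (\<phi> B) (\<iota> X \<omega>))) \<and>
    (\<forall>\<D>. (\<forall>X. \<D> (ad bracket X) = ad bracket (inv (\<phi> B) (\<iota> X \<omega>))) \<longrightarrow>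
      invertible_derivation (pointwise_scale scale) commutator (ad_algebra bracket) \<D>)"
proof -
  interpret symplectic_quadratic_lie_algebra scale bracket B \<omega> by fact
  show ?thesis
    using induced_map_exists induced_map_invertible_derivation unfolding D_def by blast
qed

end
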